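(* Let $k\in\mathbb{N}$ and for each $1\le i\le k$ let $\mathcal{D}_i$ be a sequence of integers each greater than or equal to $2$. Let $f(q):=\log^*q\cdot\log^*(\log q)$ for $q\in\mathbb{N}$. Then $$\dim\Big(\bigcap_{i=1}^k\mathrm{Bad}_{\mathcal{D}_i}(f)\Big)=1.$$
   Context: $\log^*x:=1$ if $x<e$ and $\log^*x:=\log x$ if $x\ge e$. $\|x\|$ denotes the distance from $x$ to the nearest integer. For a sequence $\mathcal{D}=(d_j)_{j\ge1}$ of integers $\ge2$, set $D_0:=1$, $D_n:=\prod_{j=1}^nd_j$, and $|q|_{\mathcal{D}}:=\inf\{D_n^{-1}: n\ge0,\ q\in D_n\mathbb{Z}\}$ for $q\in\mathbb{Z}$. Then $\mathrm{Bad}_{\mathcal{D}}(f):=\{\alpha\in\mathbb{R}:\liminf_{q\to\infty}f(q)\,q\,|q|_{\mathcal{D}}\,\|q\alpha\|>0\}$. $\dim$ is Hausdorff dimension. *)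

theory Defs
  imports "HOL-Analysis.Analysis"
begin

(* The s-th power of the diameter, with the conventions diam(U)^0 = 1 for nonempty U (whereas
   0 powr 0 = 0) and diam({})^s = 0.  It is meaningful for bounded U only: the diameter of an
   unbounded set is unspecified. *)
definition diam_pow :: "real \<Rightarrow> 'a::metric_space set \<Rightarrow> ennreal" where
  "diam_pow s U = (if U = {} then 0 else if s = 0 then 1 else ennreal (diameter U powr s))"

definition hausdorff_premeasure :: "real \<Rightarrow> real \<Rightarrow> 'a::metric_space set \<Rightarrow> ennreal" where
  "hausdorff_premeasure s \<delta> E =
     (INF U\<in>{U :: nat \<Rightarrow> 'a set. E \<subseteq> (\<Union>i. U i) \<and> (\<forall>i. bounded (U i) \<and> diameter (U i) \<le> \<delta>)}.
        \<Sum>i. diam_pow s (U i))"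

definition hausdorff_measure :: "real \<Rightarrow> 'a::metric_space set \<Rightarrow> ennreal" where
  "hausdorff_measure s E = (SUP \<delta>\<in>{0<..}. hausdorff_premeasure s \<delta> E)"

definition hausdorff_dim :: "'a::metric_space set \<Rightarrow> ennreal" where
  "hausdorff_dim E = (INF s\<in>{s. 0 \<le> s \<and> hausdorff_measure s E = 0}. ennreal s)"

definition log_star :: "real \<Rightarrow> real" where
  "log_star x = (if x < exp 1 then 1 else ln x)"

definition dist_int :: "real \<Rightarrow> real" where
  "dist_int x = \<bar>x - of_int (round x)\<bar>"

(* A sequence d_1, d_2, ... is a function on nat whose value at 0 is ignored. *)
definition partial_prod :: "(nat \<Rightarrow> int) \<Rightarrow> nat \<Rightarrow> int" where
  "partial_prod d n = (\<Prod>j=1..n. d j)"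

definition pseudo_abs :: "(nat \<Rightarrow> int) \<Rightarrow> int \<Rightarrow> real" where
  "pseudo_abs d q = Inf {1 / of_int (partial_prod d n) | n. partial_prod d n dvd q}"

(* The liminf is taken in the extended reals, since it may be infinite. *)
definition Bad :: "(nat \<Rightarrow> int) \<Rightarrow> (nat \<Rightarrow> real) \<Rightarrow> real set" where
  "Bad d f = {\<alpha>. liminf (\<lambda>q. ereal (f q * real q * pseudo_abs d (int q) * dist_int (real q * \<alpha>))) > 0}"

end

theory Submission
  imports Defs "HOL-Library.Discrete_Functions"
begin

text \<open>Write \<open>|q|_D = 1 / D_m\<close> and \<open>q = D_m q'\<close>, and call \<open>H = q\<^sup>2 |q|_D = D_m q'\<^sup>2\<close> the height of \<open>p / q\<close>. Then
  \<open>\<alpha>\<close> is in \<open>Bad\<close> as soon as it keeps a distance of at least \<open>c / (f(q) H)\<close> from all \<open>p / q\<close> with \<open>q\<close> large. For a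
  fixed \<open>m\<close>, distinct points of height less than \<open>N\<close> are at least \<open>1 / N\<close> apart, and only \<open>O(log N)\<close> values
  of \<open>m\<close> occur. So the neighbourhoods of the points with height in \<open>[N, 2 N]\<close> fill a proportion
  \<open>O(c log N / f)\<close> of each interval of length \<open>1 / N\<close>. As \<open>f\<close> is about \<open>log N log log N\<close>, heights from \<open>N\<close>
  to a power of \<open>log N\<close> times \<open>N\<close> fill only a proportion \<open>O(c)\<close>.

  Hence consider a tree of dyadic intervals whose generation \<open>n\<close> has length \<open>2 ^ - s n\<close>, where
  \<open>2 ^ (s (n + 1) - s n)\<close> is about \<open>(s n)\<^sup>2\<close>. An interval is kept if the heights of two generations ago do
  not hit it, and those of the previous generation hit at most half of its children. By counting
  grandchildren, at least a quarter of the children of a kept interval are kept.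

  The loss of a factor 4 per generation is negligible against \<open>s n\<close>, so for each \<open>\<sigma> < 1\<close> the
  enumeration of the kept intervals from left to right yields a map \<open>h\<close> from \<open>[0, 1)\<close> to the limit set
  with \<open>|x - y| \<le> C |h x - h y| ^ \<sigma>\<close>. A cover of the limit set thus pulls back to a cover of \<open>[0, 1)\<close>, and
  countable subadditivity of Lebesgue measure bounds the \<open>\<sigma>\<close>-dimensional measure from below.\<close>

subsection \<open>The upper bound for the dimension\<close>

text \<open>Harmonic lengths have a divergent sum but summable \<open>s\<close>-th powers for every
  \<open>s > 1\<close>, so they cover the line at small \<open>s\<close>-dimensional cost.\<close>

lemma harmonic_intervals_cover:
  assumes "\<eta> > 0"
  defines "U \<equiv> \<lambda>i. if even i then {\<eta> * harm (i div 2) .. \<eta> * harm (Suc (i div 2))}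
                   else {- (\<eta> * harm (Suc (i div 2))) .. - (\<eta> * harm (i div 2))}"
  shows "(\<Union>i. U i) = (UNIV :: real set)"
proof -
  have pos: "\<exists>n. \<eta> * harm n \<le> y \<and> y \<le> \<eta> * harm (Suc n)" if "y \<ge> 0" for y :: real
  proof -
    have "\<exists>n. y < \<eta> * harm n"
    proof -
      have "filterlim (harm :: nat \<Rightarrow> real) at_top sequentially"
        by (rule harm_at_top)
      then have "eventually (\<lambda>n. harm n > y / \<eta>) sequentially"
        by (simp add: filterlim_at_top_dense)
      then show ?thesis
        using \<open>\<eta> > 0\<close> by (auto simp: eventually_sequentially field_simps)
    qed
    define n where "n = (LEAST n. y < \<eta> * harm n)"
    have n: "y < \<eta> * harm n"
      unfolding n_def using \<open>\<exists>n. _\<close> by (rule LeastI_ex)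
    then have "n \<noteq> 0"
      using that by (intro notI) (simp add: harm_def)
    then obtain m where m: "n = Suc m"
      by (cases n) auto
    have "\<not> y < \<eta> * harm m"
      using not_less_Least[of m "\<lambda>n. y < \<eta> * harm n"] m by (simp add: n_def)
    then show ?thesis
      using n m by (intro exI[of _ m]) auto
  qed
  have "\<exists>i. y \<in> U i" for y :: real
  proof (cases "y \<ge> 0")
    case True
    then obtain n where "\<eta> * harm n \<le> y" "y \<le> \<eta> * harm (Suc n)"
      using pos by blast
    then show ?thesis
      by (intro exI[of _ "2 * n"]) (simp add: U_def)
  next
    case False
    then obtain n where "\<eta> * harm n \<le> - y" "- y \<le> \<eta> * harm (Suc n)"
      using pos[of "- y"] by auto
    then show ?thesis
      by (intro exI[of _ "2 * n + 1"]) (simp add: U_def)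
  qed
  then show ?thesis by blast
qed

lemma hausdorff_premeasure_real_eq_0:
  fixes E :: "real set"
  assumes "s > 1" "\<delta> > 0"
  shows "hausdorff_premeasure s \<delta> E = 0"
proof -
  define Z where "Z = (\<Sum>i. (2 / real (Suc i)) powr s)"
  have summ: "summable (\<lambda>i. (2 / real (Suc i)) powr s)"
  proof -
    have "summable (\<lambda>i. real i powr (- s))"
      using assms by (simp add: summable_real_powr_iff)
    then have "summable (\<lambda>i. 2 powr s * real (Suc i) powr (- s))"
      by (intro summable_mult) (subst summable_Suc_iff)
    then show ?thesis
      by (simp add: powr_divide powr_minus_divide)
  qed
  have le: "hausdorff_premeasure s \<delta> E \<le> ennreal (\<eta> powr s * Z)" if "0 < \<eta>" "\<eta> \<le> \<delta>" for \<eta>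
  proof -
    define U :: "nat \<Rightarrow> real set" where
      "U = (\<lambda>i. if even i then {\<eta> * harm (i div 2) .. \<eta> * harm (Suc (i div 2))}
                   else {- (\<eta> * harm (Suc (i div 2))) .. - (\<eta> * harm (i div 2))})"
    have diam: "diameter (U i) = \<eta> / real (Suc (i div 2))" for i
    proof -
      have "0 \<le> \<eta> * inverse (1 + real (i div 2))"
        using \<open>\<eta> > 0\<close> by simp
      then show ?thesis
        by (simp add: U_def harm_Suc distrib_left divide_inverse not_less[symmetric])
    qed
    \<comment> \<open>Each length serves one interval on either side of 0; passing from
      \<open>i div 2\<close> to \<open>i\<close> costs the factor 2 in \<open>Z\<close>.\<close>
    have "real (Suc i) \<le> 2 * real (Suc (i div 2))" for i
      by (cases "even i") (auto elim!: evenE oddE)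
    then have diam_le: "diameter (U i) \<le> \<eta> * (2 / real (Suc i))" for i
      using \<open>\<eta> > 0\<close> by (simp add: diam field_simps del: of_nat_Suc)
    have "diameter (U i) \<le> \<eta>" for i
      using \<open>\<eta> > 0\<close> by (simp add: diam field_simps)
    then have "diameter (U i) \<le> \<delta>" for i
      using that order_trans by blast
    moreover have "bounded (U i)" for i
      by (auto simp: U_def)
    moreover have "E \<subseteq> (\<Union>i. U i)"
      using harmonic_intervals_cover[OF \<open>\<eta> > 0\<close>] by (simp add: U_def)
    ultimately have "hausdorff_premeasure s \<delta> E \<le> (\<Sum>i. diam_pow s (U i))"
      unfolding hausdorff_premeasure_def by (intro INF_lower) auto
    also have "\<dots> \<le> (\<Sum>i. ennreal (\<eta> powr s * (2 / real (Suc i)) powr s))"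
    proof (intro suminf_le summableI)
      fix i
      have "diameter (U i) powr s \<le> (\<eta> * (2 / real (Suc i))) powr s"
        using diam_le assms \<open>\<eta> > 0\<close> by (intro powr_mono2) (auto simp: diam)
      then show "diam_pow s (U i) \<le> ennreal (\<eta> powr s * (2 / real (Suc i)) powr s)"
        using \<open>\<eta> > 0\<close> assms
        by (auto simp: diam_pow_def powr_mult powr_divide intro!: ennreal_leI)
    qed
    also have "\<dots> = ennreal (\<Sum>i. \<eta> powr s * (2 / real (Suc i)) powr s)"
      using summ by (intro suminf_ennreal2 summable_mult) auto
    also have "(\<Sum>i. \<eta> powr s * (2 / real (Suc i)) powr s) = \<eta> powr s * Z"
      using summ unfolding Z_def by (intro suminf_mult)
    finally show ?thesis .
  qed
  have "((\<lambda>\<eta>. ennreal (\<eta> powr s * Z)) \<longlongrightarrow> ennreal (0 powr s * Z)) (at_right 0)"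
    using assms by (intro tendsto_ennrealI tendsto_mult tendsto_const tendsto_powr' tendsto_ident_at)
      (auto simp: eventually_at_filter)
  then have "((\<lambda>\<eta>. ennreal (\<eta> powr s * Z)) \<longlongrightarrow> 0) (at_right 0)"
    by simp
  moreover have "eventually (\<lambda>\<eta>. hausdorff_premeasure s \<delta> E \<le> ennreal (\<eta> powr s * Z)) (at_right 0)"
    unfolding eventually_at_right_field
    using assms le by (intro exI[of _ \<delta>]) auto
  ultimately have "hausdorff_premeasure s \<delta> E \<le> 0"
    by (intro tendsto_lowerbound) auto
  then show ?thesis by simp
qed

lemma hausdorff_dim_real_le_1:
  fixes E :: "real set"
  shows "hausdorff_dim E \<le> 1"
proof (rule dense_ge)
  fix x :: ennreal
  assume x: "1 < x"
  show "hausdorff_dim E \<le> x"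
  proof (cases x rule: ennreal_cases)
    case (real s)
    with x have "s > 1"
      by (metis ennreal_less_iff ennreal_1 zero_le_one)
    then have "hausdorff_measure s E = 0"
      unfolding hausdorff_measure_def
      by (simp add: hausdorff_premeasure_real_eq_0 SUP_eq_iff)
    then show ?thesis
      unfolding hausdorff_dim_def using \<open>s > 1\<close> real by (auto intro!: INF_lower2[of s])
  qed auto
qed

subsection \<open>Hausdorff measure of the limit set of a tree\<close>

text \<open>Cells of generation \<open>n\<close> have length \<open>1 / P n\<close>, are numbered
  from the left, and split into \<open>R n\<close> children each. \<open>G n a\<close> marks cell
  \<open>a\<close> as kept.\<close>

locale cantor_tree =
  fixes R M P :: "nat \<Rightarrow> nat" and G :: "nat \<Rightarrow> nat \<Rightarrow> bool"
  assumes P0: "P 0 > 0"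
    and P_Suc: "P (Suc n) = R n * P n"
    and P_unbounded: "\<exists>n. real (P n) > B"
    and M_pos: "M n > 0"
    and root: "G 0 0"
    and children: "G n a \<Longrightarrow> M n \<le> card {t. t < R n \<and> G (Suc n) (R n * a + t)}"
begin

text \<open>Only ranks \<open>t < M n\<close> are used: this thins the tree to exactly
  \<open>M n\<close> children per cell.\<close>

definition child :: "nat \<Rightarrow> nat \<Rightarrow> nat \<Rightarrow> nat" where
  "child n a t = R n * a + sorted_list_of_set {t. t < R n \<and> G (Suc n) (R n * a + t)} ! t"

lemma child:
  assumes "G n a" "t < M n"
  shows child_good: "G (Suc n) (child n a t)"
    and child_div: "child n a t div R n = a"
    and child_mono: "t' < t \<Longrightarrow> child n a t' < child n a t"
proof -
  define S where "S = {t. t < R n \<and> G (Suc n) (R n * a + t)}"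
  have fin: "finite S"
    by (simp add: S_def)
  have len: "t < length (sorted_list_of_set S)"
    using children[OF assms(1)] assms(2) by (simp add: S_def)
  have child_eq: "child n a t' = R n * a + sorted_list_of_set S ! t'" for t'
    by (simp only: child_def S_def)
  have "sorted_list_of_set S ! t \<in> S"
    using nth_mem[OF len] fin by simp
  then have "sorted_list_of_set S ! t < R n" "G (Suc n) (R n * a + sorted_list_of_set S ! t)"
    by (auto simp: S_def)
  then show "G (Suc n) (child n a t)" "child n a t div R n = a"
    by (simp_all add: child_eq)
  show "child n a t' < child n a t" if "t' < t"
    using sorted_wrt_nth_less[OF strict_sorted_list_of_set that len] by (simp add: child_eq)
qed

text \<open>The index \<open>j\<close> is read in mixed radix with bases
  \<open>M 0, M 1, ...\<close>; the lowest digit selects the child in the last generation.\<close>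

primrec node :: "nat \<Rightarrow> nat \<Rightarrow> nat" where
  "node 0 j = 0"
| "node (Suc n) j = child n (node n (j div M n)) (j mod M n)"

definition Q :: "nat \<Rightarrow> nat" where
  "Q n = (\<Prod>i<n. M i)"

lemma Q_Suc: "Q (Suc n) = Q n * M n"
  by (simp add: Q_def)

lemma Q_pos: "Q n > 0"
  by (simp add: Q_def M_pos)

text \<open>A zero would persist through \<open>P_Suc\<close> and contradict
  \<open>P_unbounded\<close>.\<close>

lemma P_pos: "P n > 0"
proof (rule ccontr)
  assume "\<not> ?thesis"
  then have "P (n + m) = 0" for m
    by (induction m) (auto simp: P_Suc)
  moreover have "\<exists>N. P N > 0 \<and> N \<ge> n"
  proof -
    obtain N where N: "real (P N) > real (Max (P ` {..n}))"
      using P_unbounded by blast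
    have "\<not> N \<le> n"
      using N by (metis Max_ge atMost_iff finite_atMost finite_imageI imageI not_le of_nat_less_iff)
    then show ?thesis
      using N by (intro exI[of _ N]) auto
  qed
  ultimately show False
    by (metis le_Suc_ex less_irrefl)
qed

lemma node_good: "G n (node n j)"
  by (induction n arbitrary: j) (auto simp: root child_good M_pos)

lemma node_div: "node (Suc n) j div R n = node n (j div M n)"
  by (simp add: child_div node_good M_pos)

lemma node_strict_mono:
  "i < j \<Longrightarrow> j < Q n \<Longrightarrow> node n i < node n j"
proof (induction n arbitrary: i j)
  case 0
  then show ?case by (simp add: Q_def)
next
  case (Suc n)
  show ?case
  proof (cases "i div M n = j div M n")
    case True
    have "M n * (i div M n) + i mod M n < M n * (j div M n) + j mod M n"
      using Suc.prems by (simp only: mult_div_mod_eq)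
    then have "i mod M n < j mod M n"
      by (simp only: True nat_add_left_cancel_less)
    then show ?thesis
      using True by (simp add: child_mono node_good M_pos)
  next
    case False
    moreover have "i div M n \<le> j div M n"
      using Suc.prems by (intro div_le_mono) simp
    ultimately have "i div M n < j div M n"
      by simp
    moreover have "j div M n < Q n"
      using Suc.prems by (simp add: Q_Suc less_mult_imp_div_less)
    ultimately have "node n (i div M n) < node n (j div M n)"
      by (rule Suc.IH)
    then have "node (Suc n) i div R n < node (Suc n) j div R n"
      by (simp only: node_div)
    then show ?thesis
      using div_le_mono[of "node (Suc n) j" "node (Suc n) i" "R n"] by linarith
  qed
qed

text \<open>Selected cells have distinct, increasing integer numbers, so their numbers are at least
  as far apart as their indices. All distance bounds rest on this.\<close>

lemma node_diff:
  assumes "i \<le> j" "j < Q n"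
  shows "node n i + (j - i) \<le> node n j"
  using assms
proof (induction j)
  case (Suc j)
  show ?case
  proof (cases "i = Suc j")
    case False
    then show ?thesis
      using Suc node_strict_mono[of j "Suc j" n] by (simp add: Suc_diff_le)
  qed auto
qed auto

definition cell :: "nat \<Rightarrow> nat \<Rightarrow> real set" where
  "cell n a = {real a / real (P n) .. (real a + 1) / real (P n)}"

lemma cell_Suc_subset:
  assumes "b div R n = a"
  shows "cell (Suc n) b \<subseteq> cell n a"
proof -
  have R: "R n > 0"
    using P_pos[of "Suc n"] by (simp add: P_Suc)
  have "R n * a \<le> b" "b + 1 \<le> R n * (a + 1)"
    using assms R by (auto simp: Suc_le_eq dividend_less_times_div)
  then have "real (R n * a) \<le> real b" "real (b + 1) \<le> real (R n * (a + 1))"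
    by (simp_all only: of_nat_le_iff)
  then have "real (R n * a) * P n \<le> real b * P n" "real (b + 1) * P n \<le> real (R n * (a + 1)) * P n"
    by (auto intro: mult_right_mono)
  then show ?thesis
    using R P_pos[of n] by (simp add: cell_def P_Suc field_simps)
qed

section \<open>The map from [0, 1) into the limit set\<close>

definition digits :: "real \<Rightarrow> nat \<Rightarrow> nat" where
  "digits x n = nat \<lfloor>x * real (Q n)\<rfloor>"

lemma digits_div:
  assumes "0 \<le> x"
  shows "digits x (Suc n) div M n = digits x n"
proof -
  have "\<lfloor>x * real (Q (Suc n))\<rfloor> div int (M n) = \<lfloor>x * real (Q (Suc n)) / real_of_int (int (M n))\<rfloor>"
    by (rule floor_divide_real_eq_div[symmetric]) simp
  also have "x * real (Q (Suc n)) / real_of_int (int (M n)) = x * real (Q n)"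
    using M_pos[of n] by (simp add: Q_Suc)
  finally show ?thesis
    using assms by (simp add: digits_def flip: nat_div_distrib[of _ "int (M n)", simplified])
qed

lemma digits_bounds:
  assumes "0 \<le> x" "x < 1"
  shows "digits x n < Q n" "real (digits x n) \<le> x * Q n" "x * Q n < real (digits x n) + 1"
proof -
  show *: "real (digits x n) \<le> x * Q n" "x * Q n < real (digits x n) + 1"
    using assms by (auto simp: digits_def)
  have "x * Q n < Q n"
    using assms Q_pos[of n] by simp
  then show "digits x n < Q n"
    using * by linarith
qed

lemma point_exists:
  assumes "0 \<le> x" "x < 1"
  shows "\<exists>y. \<forall>n. y \<in> cell n (node n (digits x n))"
proof -
  have dec: "cell (Suc n) (node (Suc n) (digits x (Suc n))) \<subseteq> cell n (node n (digits x n))" for n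
    by (rule cell_Suc_subset) (simp only: node_div digits_div[OF assms(1)])
  have "(\<Inter>n. cell n (node n (digits x n))) \<noteq> {}"
  proof (rule compact_nest)
    show "compact (cell n (node n (digits x n)))" "cell n (node n (digits x n)) \<noteq> {}" for n
      using P_pos[of n] by (auto simp: cell_def divide_right_mono)
    show "cell n (node n (digits x n)) \<subseteq> cell m (node m (digits x m))" if "m \<le> n" for m n
      using lift_Suc_antimono_le[of "\<lambda>n. cell n (node n (digits x n))", OF dec that] .
  qed
  then show ?thesis by auto
qed

text \<open>At the first generation with \<open>d * P n \<ge> 1\<close>, points within
  \<open>d\<close> lie in cells whose numbers differ by at most \<open>d * P n + 1\<close>; by
  \<open>node_diff\<close> the indices are no further apart, and \<open>growth\<close> turns this
  into \<open>d powr s\<close>. A free bound \<open>d > 0\<close> in place of the distance covers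
  \<open>u = v\<close>.\<close>

lemma point_separation:
  assumes xy: "0 \<le> x" "x < 1" "0 \<le> y" "y < 1"
    and u: "\<And>n. u \<in> cell n (node n (digits x n))"
    and v: "\<And>n. v \<in> cell n (node n (digits y n))"
    and s: "s < 1"
    and growth: "\<And>n. real (P (Suc n)) \<le> C * real (Q (Suc n)) * real (P n) powr (1 - s)"
    and d: "\<bar>u - v\<bar> \<le> d" "0 < d" "d * real (P 0) < 1"
  shows "\<bar>x - y\<bar> \<le> 3 * C * d powr s"
  using xy u v d(1)
proof (induction x y arbitrary: u v rule: linorder_wlog)
  case (le x y)
  obtain N where "real (P N) > 1 / d"
    using P_unbounded by blast
  then have ex: "\<exists>N. d * real (P N) \<ge> 1"
    using d by (intro exI[of _ N]) (simp add: field_simps)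
  define n where "n = (LEAST N. d * real (P N) \<ge> 1)"
  have n: "d * real (P n) \<ge> 1"
    unfolding n_def by (rule LeastI_ex[OF ex])
  \<comment> \<open>\<open>d * P 0 < 1\<close> rules out \<open>n = 0\<close>; cells of generation
    \<open>m\<close> are still longer than \<open>d\<close>.\<close>
  then obtain m where m: "n = Suc m"
    using d by (cases n) auto
  have "\<not> d * real (P m) \<ge> 1"
    using not_less_Least[of m "\<lambda>N. d * real (P N) \<ge> 1"] m by (simp add: n_def)
  then have Pm: "real (P m) < 1 / d"
    using d by (simp add: field_simps)
  have Pn: "real (P n) > 0" and Qn: "real (Q n) > 0"
    using P_pos Q_pos by auto
  have "x * Q n \<le> y * Q n"
    using le by (intro mult_right_mono) auto
  then have "digits x n \<le> digits y n"
    unfolding digits_def by (intro nat_mono floor_mono)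
  then have "node n (digits x n) + (digits y n - digits x n) \<le> node n (digits y n)"
    using le by (intro node_diff digits_bounds)
  then have "real (digits y n) - real (digits x n) \<le> real (node n (digits y n)) - real (node n (digits x n))"
    by linarith
  also have "\<dots> \<le> (v - u) * P n + 1"
    using le(6)[of n] le(7)[of n] Pn by (simp add: cell_def field_simps)
  also have "\<dots> \<le> d * P n + 1"
    using le(8) Pn by (intro add_right_mono mult_right_mono) auto
  \<comment> \<open>One unit is the length of a cell, the other the rounding in
    \<open>digits\<close>; \<open>d * P n \<ge> 1\<close> absorbs both.\<close>
  finally have "y * Q n - x * Q n \<le> d * P n + 2"
    using digits_bounds(2)[of x n] digits_bounds(3)[of y n] le by linarith
  also have "\<dots> \<le> 3 * d * P n"
    using n by linarith
  also have "\<dots> \<le> 3 * d * (C * real (Q n) * real (P m) powr (1 - s))"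
    using growth[of m] d m by (intro mult_left_mono) auto
  finally have "(y - x) * Q n \<le> (3 * d * C * real (P m) powr (1 - s)) * Q n"
    by (simp add: algebra_simps)
  then have "y - x \<le> 3 * d * C * real (P m) powr (1 - s)"
    using Qn by (simp only: mult_le_cancel_right_pos)
  also have "\<dots> \<le> 3 * d * C * (1 / d) powr (1 - s)"
  proof (intro mult_left_mono powr_mono2)
    have "0 < C * real (Q n) * real (P m) powr (1 - s)"
      using growth[of m] Pn m by simp
    then have "C > 0"
      using Qn by (simp add: zero_less_mult_iff split: if_splits)
    then show "0 \<le> 3 * d * C"
      using d by simp
  qed (use s Pm in auto)
  also have "\<dots> = 3 * C * (d powr 1 * (1 / d) powr (1 - s))"
    using d by simp
  also have "d powr 1 * (1 / d) powr (1 - s) = d powr s"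
    using d by (simp add: powr_divide powr_diff)
  finally show ?case
    using le by simp
next
  case (sym x y)
  have "\<bar>v - u\<bar> \<le> d"
    using sym.prems by (simp add: abs_minus_commute)
  then have "\<bar>y - x\<bar> \<le> 3 * C * d powr s"
    using sym.prems by (intro sym(1)[of v u])
  then show ?case
    by (simp add: abs_minus_commute)
qed

text \<open>A cover of \<open>E\<close> pulls back along \<open>h\<close> to a cover of [0, 1),
  whose intervals have total length at least 1, while \<open>point_separation\<close> bounds each
  length by \<open>diam_pow\<close>. No measure on the limit set has to be constructed.\<close>

theorem hausdorff_measure_nonzero:
  assumes s: "0 \<le> s" "s < 1"
    and growth: "\<And>n. real (P (Suc n)) \<le> C * real (\<Prod>i<Suc n. M i) * real (P n) powr (1 - s)"
    and E: "\<And>y. (\<And>n. \<exists>a. G n a \<and> y \<in> {real a / real (P n) .. (real a + 1) / real (P n)}) \<Longrightarrow> y \<in> E"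
  shows "hausdorff_measure s E \<noteq> 0"
proof -
  have growth': "real (P (Suc n)) \<le> C * real (Q (Suc n)) * real (P n) powr (1 - s)" for n
    using growth[of n] by (simp only: Q_def)
  have "0 < C * real (Q (Suc 0)) * real (P 0) powr (1 - s)"
    using growth'[of 0] P_pos[of 1] by simp
  then have C: "C > 0"
    using Q_pos[of "Suc 0"] by (simp add: zero_less_mult_iff split: if_splits)
  obtain h where h: "h x \<in> cell n (node n (digits x n))" if "0 \<le> x" "x < 1" for x n
    using point_exists by metis
  have h_E: "h x \<in> E" if "0 \<le> x" "x < 1" for x
    using h[OF that] node_good unfolding cell_def by (intro E) blast
  define \<delta> where "\<delta> = 1 / (2 * real (P 0))"
  have \<delta>: "\<delta> > 0" "\<delta> * P 0 < 1"
    using P0 by (auto simp: \<delta>_def)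
  \<comment> \<open>Enclosing preimages in closed intervals avoids any question of measurability of
    \<open>h\<close>.\<close>
  have interval: "\<exists>l u. {x\<in>{0..<1}. h x \<in> V} \<subseteq> {l..u} \<and> ennreal (u - l) \<le> ennreal (6 * C) * diam_pow s V \<and> l \<le> u"
    if V: "bounded V" "diameter V \<le> \<delta>" for V
  proof (cases "{x\<in>{0..<1}. h x \<in> V} = {}")
    case True
    then show ?thesis
      by (metis diff_self empty_subsetI ennreal_0 order_refl zero_le)
  next
    case False
    then obtain x0 where x0: "0 \<le> x0" "x0 < 1" "h x0 \<in> V"
      by auto
    \<comment> \<open>The real value of \<open>diam_pow s V\<close>; the case split matters since
      \<open>0 powr 0 = 0\<close>.\<close>
    define D where "D = (if s = 0 then 1 else diameter V powr s)"
    have D: "\<bar>x - x0\<bar> \<le> 3 * C * D" if x: "0 \<le> x" "x < 1" "h x \<in> V" for x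
    proof -
      have dist: "\<bar>h x - h x0\<bar> \<le> diameter V"
        using diameter_bounded_bound[OF V(1) x(3) x0(3)] by (simp add: dist_real_def)
      have sep: "\<bar>x - x0\<bar> \<le> 3 * C * d powr s" if "diameter V \<le> d" "0 < d" "d \<le> \<delta>" for d
      proof (rule point_separation[where u = "h x" and v = "h x0"])
        show "d * P 0 < 1"
          using \<delta> that by (meson le_less_trans mult_right_mono of_nat_0_le_iff)
      qed (use x x0 h s growth' dist that in auto)
      consider "s = 0" | "s > 0" "diameter V > 0" | "s > 0" "diameter V = 0"
        using s diameter_ge_0[OF V(1)] by fastforce
      then show ?thesis
      proof cases
        case 1
        then show ?thesis
          using sep[of \<delta>] V \<delta> by (simp add: D_def)
      next
        case 2
        then show ?thesis
          using sep[of "diameter V"] V by (simp add: D_def)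
      next
        case 3
        \<comment> \<open>\<open>point_separation\<close> requires \<open>d > 0\<close>, so diameter
          0 is reached as a limit.\<close>
        have "((\<lambda>d. 3 * C * d powr s) \<longlongrightarrow> 3 * C * 0 powr s) (at_right 0)"
          using 3 by (intro tendsto_mult tendsto_const tendsto_powr' tendsto_ident_at)
            (auto simp: eventually_at_filter)
        moreover have "eventually (\<lambda>d. \<bar>x - x0\<bar> \<le> 3 * C * d powr s) (at_right 0)"
          unfolding eventually_at_right_field
          using \<delta> 3 sep by (intro exI[of _ \<delta>]) auto
        ultimately have "\<bar>x - x0\<bar> \<le> 3 * C * 0 powr s"
          by (intro tendsto_lowerbound) auto
        then show ?thesis
          using 3 by (simp add: D_def)
      qed
    qed
    have "D \<ge> 0"
      by (simp add: D_def)
    have "V \<noteq> {}"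
      using x0 by auto
    then have dp: "diam_pow s V = ennreal D"
      by (simp add: D_def diam_pow_def)
    show ?thesis
    proof (rule exI[of _ "x0 - 3 * C * D"], rule exI[of _ "x0 + 3 * C * D"], intro conjI)
      show "{x \<in> {0..<1}. h x \<in> V} \<subseteq> {x0 - 3 * C * D..x0 + 3 * C * D}"
        using D by (force simp: abs_le_iff)
      show "ennreal (x0 + 3 * C * D - (x0 - 3 * C * D)) \<le> ennreal (6 * C) * diam_pow s V"
        using C \<open>D \<ge> 0\<close> by (simp add: dp flip: ennreal_mult)
      show "x0 - 3 * C * D \<le> x0 + 3 * C * D"
        using C \<open>D \<ge> 0\<close> by simp
    qed
  qed
  have bound: "1 \<le> ennreal (6 * C) * (\<Sum>i. diam_pow s (U i))"
    if U: "E \<subseteq> (\<Union>i. U i)" "\<And>i. bounded (U i) \<and> diameter (U i) \<le> \<delta>" for U :: "nat \<Rightarrow> real set"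
  proof -
    have "\<forall>i. \<exists>l u. {x\<in>{0..<1}. h x \<in> U i} \<subseteq> {l..u}
        \<and> ennreal (u - l) \<le> ennreal (6 * C) * diam_pow s (U i) \<and> l \<le> u"
      using interval U(2) by blast
    from choice[OF this] obtain l where
      "\<forall>i. \<exists>u. {x\<in>{0..<1}. h x \<in> U i} \<subseteq> {l i..u}
        \<and> ennreal (u - l i) \<le> ennreal (6 * C) * diam_pow s (U i) \<and> l i \<le> u"
      by blast
    from choice[OF this] obtain u where lu: "{x\<in>{0..<1}. h x \<in> U i} \<subseteq> {l i..u i}"
      "ennreal (u i - l i) \<le> ennreal (6 * C) * diam_pow s (U i)" "l i \<le> u i" for i
      by blast
    have "{0..<1} \<subseteq> (\<Union>i. {l i..u i})"
    proof
      fix x :: real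
      assume x: "x \<in> {0..<1}"
      then obtain i where "h x \<in> U i"
        using h_E[of x] U(1) by auto
      then show "x \<in> (\<Union>i. {l i..u i})"
        using x lu(1)[of i] by blast
    qed
    then have "emeasure lborel {0..<1::real} \<le> emeasure lborel (\<Union>i. {l i..u i})"
      by (intro emeasure_mono) auto
    also have "\<dots> \<le> (\<Sum>i. emeasure lborel {l i..u i})"
      by (intro emeasure_subadditive_countably) auto
    also have "\<dots> \<le> (\<Sum>i. ennreal (6 * C) * diam_pow s (U i))"
      using lu by (intro suminf_le summableI) auto
    finally show ?thesis
      by (simp)
  qed
  have "ennreal (1 / (6 * C)) \<le> hausdorff_premeasure s \<delta> E"
    unfolding hausdorff_premeasure_def
  proof (rule INF_greatest, clarify)
    fix U :: "nat \<Rightarrow> real set"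
    assume "E \<subseteq> (\<Union>i. U i)" "\<forall>i. bounded (U i) \<and> diameter (U i) \<le> \<delta>"
    then have "1 \<le> ennreal (6 * C) * (\<Sum>i. diam_pow s (U i))"
      by (intro bound) auto
    then have "ennreal (1 / (6 * C)) * 1 \<le> ennreal (1 / (6 * C)) * (ennreal (6 * C) * (\<Sum>i. diam_pow s (U i)))"
      by (intro mult_left_mono) auto
    also have "\<dots> = (\<Sum>i. diam_pow s (U i))"
      using C by (simp add: mult.assoc[symmetric] flip: ennreal_mult)
    finally show "ennreal (1 / (6 * C)) \<le> (\<Sum>i. diam_pow s (U i))"
      by simp
  qed
  also have "\<dots> \<le> hausdorff_measure s E"
    unfolding hausdorff_measure_def using \<delta> by (intro SUP_upper) auto
  finally show ?thesis
    using C by (auto simp: ennreal_eq_0_iff)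
qed

end

subsection \<open>Counting intervals near rational points\<close>

text \<open>Half-open buckets of length \<open>\<delta>\<close> hold at most one point each.\<close>

lemma card_separated_le:
  fixes S :: "real set"
  assumes S: "S \<subseteq> {A..A + L}" and sep: "\<And>x y. x \<in> S \<Longrightarrow> y \<in> S \<Longrightarrow> x \<noteq> y \<Longrightarrow> \<bar>x - y\<bar> \<ge> \<delta>"
    and "\<delta> > 0" "L \<ge> 0"
  shows "finite S \<and> real (card S) \<le> L / \<delta> + 1"
proof (rule conjI)
  define g where "g = (\<lambda>x. nat \<lfloor>(x - A) / \<delta>\<rfloor>)"
  have inj: "inj_on g S"
  proof (rule inj_onI, rule ccontr)
    fix x y assume xy: "x \<in> S" "y \<in> S" "g x = g y" "x \<noteq> y"
    then have "(x - A) / \<delta> \<ge> 0" "(y - A) / \<delta> \<ge> 0"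
      using S \<open>\<delta> > 0\<close> by auto
    then have "\<lfloor>(x - A) / \<delta>\<rfloor> = \<lfloor>(y - A) / \<delta>\<rfloor>"
      using xy(3) by (simp add: g_def eq_nat_nat_iff)
    then have "\<bar>(x - A) / \<delta> - (y - A) / \<delta>\<bar> < 1"
      by linarith
    also have "(x - A) / \<delta> - (y - A) / \<delta> = (x - y) / \<delta>"
      by (simp add: diff_divide_distrib)
    finally have "\<bar>x - y\<bar> < \<delta>"
      using \<open>\<delta> > 0\<close> by (simp add: abs_divide)
    then show False
      using sep[OF xy(1,2,4)] by simp
  qed
  have sub: "g ` S \<subseteq> {..nat \<lfloor>L / \<delta>\<rfloor>}"
    using S \<open>\<delta> > 0\<close> by (auto simp: g_def intro!: nat_mono floor_mono divide_right_mono)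
  show "finite S"
    using finite_imageD[OF finite_subset[OF sub] inj] by simp
  have "card S \<le> card {..nat \<lfloor>L / \<delta>\<rfloor>}"
    by (rule card_inj_on_le[OF inj sub]) simp
  then have "real (card S) \<le> real (nat \<lfloor>L / \<delta>\<rfloor>) + 1"
    by simp
  also have "\<dots> \<le> L / \<delta> + 1"
    using assms by simp
  finally show "real (card S) \<le> L / \<delta> + 1" .
qed

definition dyadic :: "nat \<Rightarrow> nat \<Rightarrow> real set" where
  "dyadic T v = {real v / 2 ^ T .. (real v + 1) / 2 ^ T}"

lemma card_dyadic_near_point:
  assumes "r > 0"
  shows "finite {v. \<exists>\<alpha>\<in>dyadic T v. \<bar>\<alpha> - x\<bar> < r}"
    and "real (card {v. \<exists>\<alpha>\<in>dyadic T v. \<bar>\<alpha> - x\<bar> < r}) \<le> 2 * r * 2 ^ T + 2"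
proof -
  let ?V = "{v. \<exists>\<alpha>\<in>dyadic T v. \<bar>\<alpha> - x\<bar> < r}"
  have sub: "real ` ?V \<subseteq> {(x - r) * 2 ^ T - 1 .. ((x - r) * 2 ^ T - 1) + (2 * r * 2 ^ T + 1)}"
  proof (rule image_subsetI)
    fix v
    assume "v \<in> ?V"
    then obtain \<alpha> where "\<alpha> \<in> dyadic T v" "\<bar>\<alpha> - x\<bar> < r"
      by auto
    then have "x - r \<le> (real v + 1) / 2 ^ T" "real v / 2 ^ T \<le> x + r"
      unfolding dyadic_def by auto
    then show "real v \<in> {(x - r) * 2 ^ T - 1 .. ((x - r) * 2 ^ T - 1) + (2 * r * 2 ^ T + 1)}"
      by (simp add: field_simps)
  qed
  have *: "finite (real ` ?V) \<and> real (card (real ` ?V)) \<le> (2 * r * 2 ^ T + 1) / 1 + 1"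
  proof (rule card_separated_le[OF sub])
    fix y z assume "y \<in> real ` ?V" "z \<in> real ` ?V" "y \<noteq> z"
    then obtain v w where "y = real v" "z = real w" "v \<noteq> w"
      by auto
    then show "1 \<le> \<bar>y - z\<bar>"
      by (cases v w rule: linorder_cases) auto
  qed (use assms in auto)
  show "finite ?V" "real (card ?V) \<le> 2 * r * 2 ^ T + 2"
    using * by (simp_all add: card_image finite_image_iff)
qed

text \<open>Only points of \<open>X\<close> within \<open>r\<close> of \<open>I\<close> matter. By
  \<open>4 * r * 2 ^ b \<le> 1\<close>, enlarging \<open>I\<close> by \<open>2 * r\<close> costs at
  most one more gap between points of \<open>X\<close>.\<close>

lemma card_dyadic_near_separated:
  fixes X :: "real set"
  assumes sep: "\<And>x y. x \<in> X \<Longrightarrow> y \<in> X \<Longrightarrow> x \<noteq> y \<Longrightarrow> \<bar>x - y\<bar> \<ge> 1 / 2 ^ (b + 1)"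
    and b: "S \<le> b" and r: "r > 0" "4 * r * 2 ^ b \<le> 1" and I: "I = {A .. A + 1 / 2 ^ S}"
  shows "real (card {v. dyadic T v \<subseteq> I \<and> (\<exists>x\<in>X. \<exists>\<alpha>\<in>dyadic T v. \<bar>\<alpha> - x\<bar> < r)})
           \<le> 2 ^ (b - S + 2) * (2 * r * 2 ^ T + 2)"
proof -
  define Y where "Y = X \<inter> {A - r .. (A - r) + (1 / 2 ^ S + 2 * r)}"
  have Y: "finite Y \<and> real (card Y) \<le> (1 / 2 ^ S + 2 * r) / (1 / 2 ^ (b + 1)) + 1"
    by (rule card_separated_le[where A = "A - r" and L = "1 / 2 ^ S + 2 * r" and \<delta> = "1 / 2 ^ (b + 1)"],
        use r sep in \<open>auto simp: Y_def\<close>)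
  have pow: "(2::real) ^ b = 2 ^ S * 2 ^ (b - S)"
    using b by (simp flip: power_add)
  have "(1 / 2 ^ S + 2 * r) / (1 / 2 ^ (b + 1)) = 2 * 2 ^ (b - S) + 4 * r * (2::real) ^ b"
    by (simp add: pow field_simps)
  then have "real (card Y) \<le> 2 * 2 ^ (b - S) + 1 + 1"
    using Y r by linarith
  also have "\<dots> \<le> 2 ^ (b - S + 2)"
    using one_le_power[of "2::real" "b - S"] by simp
  finally have cardY: "real (card Y) \<le> 2 ^ (b - S + 2)" .
  let ?N = "\<lambda>x. {v. \<exists>\<alpha>\<in>dyadic T v. \<bar>\<alpha> - x\<bar> < r}"
  have "{v. dyadic T v \<subseteq> I \<and> (\<exists>x\<in>X. \<exists>\<alpha>\<in>dyadic T v. \<bar>\<alpha> - x\<bar> < r)} \<subseteq> (\<Union>x\<in>Y. ?N x)"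
  proof clarify
    fix v x \<alpha>
    assume v: "dyadic T v \<subseteq> I" "x \<in> X" "\<alpha> \<in> dyadic T v" "\<bar>\<alpha> - x\<bar> < r"
    then have "\<alpha> \<in> I"
      by blast
    then have "x \<in> Y"
      using v I by (auto simp: Y_def)
    then show "v \<in> (\<Union>x\<in>Y. ?N x)"
      using v by blast
  qed
  then have "card {v. dyadic T v \<subseteq> I \<and> (\<exists>x\<in>X. \<exists>\<alpha>\<in>dyadic T v. \<bar>\<alpha> - x\<bar> < r)} \<le> card (\<Union>x\<in>Y. ?N x)"
    using Y card_dyadic_near_point[OF r(1)] by (intro card_mono) auto
  also have "\<dots> \<le> (\<Sum>x\<in>Y. card (?N x))"
    by (rule card_UN_le[OF conjunct1[OF Y]])
  finally have "real (card {v. dyadic T v \<subseteq> I \<and> (\<exists>x\<in>X. \<exists>\<alpha>\<in>dyadic T v. \<bar>\<alpha> - x\<bar> < r)})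
      \<le> (\<Sum>x\<in>Y. real (card (?N x)))"
    by (simp flip: of_nat_sum)
  also have "\<dots> \<le> (\<Sum>x\<in>Y. 2 * r * 2 ^ T + 2)"
    by (intro sum_mono card_dyadic_near_point r)
  also have "\<dots> = real (card Y) * (2 * r * 2 ^ T + 2)"
    by simp
  also have "\<dots> \<le> 2 ^ (b - S + 2) * (2 * r * 2 ^ T + 2)"
    using cardY r by (intro mult_right_mono) auto
  finally show ?thesis .
qed

text \<open>Here \<open>q\<close> is the cofactor: the denominator is \<open>D * q\<close>, so the
  height is its square divided by \<open>D\<close>.\<close>

definition bounded_height :: "int \<Rightarrow> int \<Rightarrow> real set" where
  "bounded_height D N = {of_int p / of_int (D * q) | p q. q \<ge> 1 \<and> D * q\<^sup>2 < N}"

text \<open>The factor \<open>D\<close> enters the common denominator \<open>D * q * q'\<close> only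
  once, and this denominator is at most the larger of the two heights.\<close>

lemma bounded_height_separated:
  assumes "D > 0" "N > 0" "x \<in> bounded_height D N" "y \<in> bounded_height D N" "x \<noteq> y"
  shows "\<bar>x - y\<bar> \<ge> 1 / of_int N"
proof -
  obtain p q where x: "x = of_int p / of_int (D * q)" "q \<ge> 1" "D * q\<^sup>2 < N"
    using assms(3) by (auto simp: bounded_height_def)
  obtain p' q' where y: "y = of_int p' / of_int (D * q')" "q' \<ge> 1" "D * q'\<^sup>2 < N"
    using assms(4) by (auto simp: bounded_height_def)
  have "q * q' \<le> q\<^sup>2 \<or> q * q' \<le> q'\<^sup>2"
    using x y by (cases "q \<le> q'") (auto simp: power2_eq_square)
  then have "D * (q * q') \<le> D * q\<^sup>2 \<or> D * (q * q') \<le> D * q'\<^sup>2"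
    using assms(1) by auto
  then have N: "D * q * q' \<le> N"
    using x y by auto
  have pos: "real_of_int (D * q * q') > 0"
    using x y assms by (simp del: of_int_mult)
  have eq: "x - y = of_int (p * q' - p' * q) / of_int (D * q * q')"
    using x(2) y(2) assms(1) unfolding x(1) y(1) by (simp add: divide_simps)
  then have "p * q' - p' * q \<noteq> 0"
    using assms(5) by (metis of_int_0 div_0 eq_iff_diff_eq_0)
  then have "1 \<le> \<bar>p * q' - p' * q\<bar>"
    by linarith
  then have "1 \<le> real_of_int \<bar>p * q' - p' * q\<bar>"
    by linarith
  then have "1 / of_int (D * q * q') \<le> \<bar>real_of_int (p * q' - p' * q)\<bar> / of_int (D * q * q')"
    using pos by (intro divide_right_mono) auto
  also have "\<dots> = \<bar>x - y\<bar>"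
    using pos by (simp only: eq abs_divide abs_of_pos)
  finally have "1 / of_int (D * q * q') \<le> \<bar>x - y\<bar>" .
  moreover have "1 / real_of_int N \<le> 1 / of_int (D * q * q')"
    using N pos by (intro divide_left_mono) (simp_all only: of_int_le_iff, use assms in auto)
  ultimately show ?thesis
    by linarith
qed

text \<open>A child with more than half of its own children hit uses up over
  \<open>R (Suc n) / 2\<close> of the at most \<open>R n * R (Suc n) / 8\<close> hit grandchildren,
  so at most a quarter of the children are such. At most half are hit themselves; a quarter
  remains.\<close>

lemma two_step_avoidance:
  fixes R :: "nat \<Rightarrow> nat" and h :: "nat \<Rightarrow> nat \<Rightarrow> bool"
  assumes R: "R (Suc n) > 0"
    and sparse: "8 * card {u. u < R n * R (Suc n) \<and> h (Suc n) (R n * R (Suc n) * a + u)} \<le> R n * R (Suc n)"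
    and half: "2 * card {t. t < R n \<and> h n (R n * a + t)} \<le> R n"
  shows "R n \<le> 4 * card {t. t < R n \<and> \<not> h n (R n * a + t) \<and>
           2 * card {u. u < R (Suc n) \<and> h (Suc n) (R (Suc n) * (R n * a + t) + u)} \<le> R (Suc n)}"
    (is "_ \<le> 4 * card ?good")
proof -
  let ?K = "\<lambda>t. {u. u < R (Suc n) \<and> h (Suc n) (R (Suc n) * (R n * a + t) + u)}"
  let ?A = "{t. t < R n \<and> h n (R n * a + t)}"
  let ?B = "{t. t < R n \<and> 2 * card (?K t) > R (Suc n)}"
  let ?C = "{u. u < R n * R (Suc n) \<and> h (Suc n) (R n * R (Suc n) * a + u)}"
  have "card (SIGMA t:?B. ?K t) \<le> card ?C"
  proof (rule card_inj_on_le[where f = "\<lambda>(t, u). R (Suc n) * t + u"])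
    show "inj_on (\<lambda>(t, u). R (Suc n) * t + u) (SIGMA t:?B. ?K t)"
    proof (rule inj_onI, clarify)
      fix t u t' u'
      assume u: "u < R (Suc n)" "u' < R (Suc n)" and eq: "R (Suc n) * t + u = R (Suc n) * t' + u'"
      have "(R (Suc n) * t + u) div R (Suc n) = t" "(R (Suc n) * t' + u') div R (Suc n) = t'"
        using u by simp_all
      then have "t = t'"
        by (simp only: eq)
      then show "t = t' \<and> u = u'"
        using eq by simp
    qed
    show "(\<lambda>(t, u). R (Suc n) * t + u) ` (SIGMA t:?B. ?K t) \<subseteq> ?C"
    proof clarify
      fix t u
      assume t: "t < R n" and u: "u < R (Suc n)" and h: "h (Suc n) (R (Suc n) * (R n * a + t) + u)"
      have "R (Suc n) * t + u < R (Suc n) * Suc t"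
        using u by simp
      also have "\<dots> \<le> R (Suc n) * R n"
        using t by (intro mult_le_mono2) simp
      finally have "R (Suc n) * t + u < R n * R (Suc n)"
        by (simp add: mult.commute)
      moreover have "R n * R (Suc n) * a + (R (Suc n) * t + u) = R (Suc n) * (R n * a + t) + u"
        by (simp add: algebra_simps)
      ultimately show "R (Suc n) * t + u < R n * R (Suc n) \<and> h (Suc n) (R n * R (Suc n) * a + (R (Suc n) * t + u))"
        using h by (simp only:)
    qed
  qed simp
  then have sum: "(\<Sum>t\<in>?B. card (?K t)) \<le> card ?C"
    by simp
  have "card ?B * R (Suc n) = (\<Sum>t\<in>?B. R (Suc n))"
    by simp
  also have "\<dots> \<le> (\<Sum>t\<in>?B. 2 * card (?K t))"
    by (intro sum_mono) auto
  also have "\<dots> \<le> 2 * card ?C"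
    using sum by (simp flip: sum_distrib_left)
  finally have "4 * card ?B * R (Suc n) \<le> R n * R (Suc n)"
    using sparse by linarith
  then have B: "4 * card ?B \<le> R n"
    using R by simp
  have "{..<R n} \<subseteq> ?good \<union> (?A \<union> ?B)"
    by auto
  then have "card {..<R n} \<le> card (?good \<union> (?A \<union> ?B))"
    by (intro card_mono) auto
  also have "\<dots> \<le> card ?good + (card ?A + card ?B)"
    by (meson add_left_mono card_Un_le order_trans)
  finally show ?thesis
    using B half by simp
qed

subsection \<open>Badly approximable points\<close>

lemma partial_prod_ge_power:
  assumes "\<And>j. j \<ge> 1 \<Longrightarrow> d j \<ge> 2"
  shows "2 ^ n \<le> partial_prod d n"
proof -
  have "(\<Prod>j=1..n. 2::int) \<le> (\<Prod>j=1..n. d j)"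
    using assms by (intro prod_mono) auto
  then show ?thesis
    by (simp add: partial_prod_def)
qed

text \<open>The infimum runs over a nonempty finite set, since a partial product dividing
  \<open>q\<close> satisfies \<open>n < 2 ^ n \<le> partial_prod d n \<le> q\<close>.\<close>

lemma pseudo_abs_attained:
  assumes d: "\<And>j. j \<ge> 1 \<Longrightarrow> d j \<ge> 2" and "q > 0"
  obtains n where "partial_prod d n dvd q" "pseudo_abs d q = 1 / of_int (partial_prod d n)"
proof -
  define N where "N = {n. partial_prod d n dvd q}"
  have "n \<le> nat q" if "n \<in> N" for n
  proof -
    have "int n < 2 ^ n"
      by (metis less_exp of_nat_less_iff of_nat_numeral of_nat_power)
    also have "\<dots> \<le> partial_prod d n"
      by (rule partial_prod_ge_power[OF d])
    also have "\<dots> \<le> q"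
      using that \<open>q > 0\<close> by (auto simp: N_def intro: zdvd_imp_le)
    finally show ?thesis by linarith
  qed
  then have "finite N"
    by (meson finite_nat_set_iff_bounded_le)
  moreover have "0 \<in> N"
    by (simp add: N_def partial_prod_def)
  moreover have eq: "{1 / of_int (partial_prod d n) | n. partial_prod d n dvd q}
      = (\<lambda>n. 1 / real_of_int (partial_prod d n)) ` N"
    by (auto simp: N_def)
  ultimately have "pseudo_abs d q \<in> (\<lambda>n. 1 / real_of_int (partial_prod d n)) ` N"
    unfolding pseudo_abs_def eq by (subst cInf_eq_Min) (auto intro!: Min_in)
  then show ?thesis
    using that by (auto simp: N_def)
qed

lemma log_star_ge_ln: "log_star x \<ge> ln x" if "x > 0"
proof -
  have "ln x \<le> ln (exp 1)" if "x < exp 1"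
    using that \<open>x > 0\<close> by (subst ln_le_cancel_iff) auto
  then show ?thesis
    by (auto simp: log_star_def)
qed

section \<open>Lengths of the generations\<close>

locale avoidance =
  fixes k :: nat and D :: "nat \<Rightarrow> nat \<Rightarrow> int"
  assumes k: "k \<ge> 1" and D: "\<And>i j. i \<in> {1..k} \<Longrightarrow> j \<ge> 1 \<Longrightarrow> D i j \<ge> 2"
begin

text \<open>The increment puts \<open>2 ^ a n\<close> within a factor 4 of the square of
  \<open>s n\<close>, which outgrows the number of pairs \<open>(i, m)\<close> in
  \<open>hit\<close>. The start \<open>1024 * k\<close> supplies the constant in
  \<open>two_power_a_Suc\<close>.\<close>

primrec s :: "nat \<Rightarrow> nat" where
  "s 0 = 1024 * k"
| "s (Suc n) = s n + 2 * floor_log (s n)"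

definition a :: "nat \<Rightarrow> nat" where
  "a n = 2 * floor_log (s n)"

lemma s_Suc: "s (Suc n) = s n + a n"
  by (simp add: a_def)

declare s.simps(2) [simp del]

lemma s_mono: "m \<le> n \<Longrightarrow> s m \<le> s n"
  by (rule lift_Suc_mono_le[of s]) (simp add: s_Suc)

lemma s_ge: "s n \<ge> 1024 * k"
  using s_mono[of 0 n] by simp

lemma s_ge_1024: "s n \<ge> 1024"
  using s_ge[of n] k by linarith

lemma two_power_a: "2 ^ a n \<le> (s n)\<^sup>2" "(s n)\<^sup>2 \<le> 4 * 2 ^ a n"
proof -
  have "2 ^ floor_log (s n) \<le> s n"
    using s_ge_1024[of n] by (intro floor_log_exp2_le) simp
  from power_mono[OF this, of 2] show "2 ^ a n \<le> (s n)\<^sup>2"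
    by (simp only: a_def power_even_eq)
  from power_mono[OF floor_log_exp2_ge[of "s n"], of 2] show "(s n)\<^sup>2 \<le> 4 * 2 ^ a n"
    by (simp add: a_def power_mult_distrib power_even_eq)
qed

lemma a_mono: "m \<le> n \<Longrightarrow> a m \<le> a n"
  by (simp add: a_def floor_log_le_iff s_mono)

lemma a_ge_2: "a n \<ge> 2"
proof -
  have "floor_log 2 \<le> floor_log (s n)"
    using s_ge_1024[of n] by (intro floor_log_le_iff) simp
  then show ?thesis
    using floor_log_power[of 1] by (simp add: a_def)
qed

lemma two_power_a_diff: "(2::'a::comm_semiring_1) ^ a n = 4 * 2 ^ (a n - 2)"
proof -
  obtain j where "a n = 2 + j"
    using le_Suc_ex[OF a_ge_2] by blast
  then show ?thesis
    by simp
qed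

lemma a_le_s: "a n \<le> s n"
proof -
  have "2 * x \<le> 2 ^ x" for x :: nat
  proof (cases x)
    case (Suc y)
    have "Suc y \<le> 2 ^ y"
      by (simp add: Suc_le_eq)
    then show ?thesis
      unfolding Suc power_Suc by (rule mult_le_mono2)
  qed simp
  then have "a n \<le> 2 ^ floor_log (s n)"
    by (simp add: a_def)
  also have "\<dots> \<le> s n"
    using s_ge_1024[of n] by (intro floor_log_exp2_le) simp
  finally show ?thesis .
qed

lemma s_ge_self: "n \<le> s n"
proof (induction n)
  case (Suc n)
  then show ?case
    using a_ge_2[of n] by (simp add: s_Suc)
qed simp

lemma a_ge: "2 * j \<le> a (2 ^ j)"
proof -
  have "floor_log (2 ^ j) \<le> floor_log (s (2 ^ j))"
    by (intro floor_log_le_iff s_ge_self)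
  then show ?thesis
    by (simp add: a_def)
qed

lemma two_power_a_Suc: "256 * k * s n \<le> 2 ^ a (Suc n)"
proof -
  have "4 * (256 * k * s n) \<le> s n * s n"
    using s_ge[of n] by simp
  also have "\<dots> \<le> 4 * 2 ^ a n"
    using two_power_a(2)[of n] by (simp add: power2_eq_square)
  also have "\<dots> \<le> 4 * 2 ^ a (Suc n)"
    using a_mono[of n "Suc n"] by simp
  finally show ?thesis by simp
qed

section \<open>Neighbourhoods of rational points and the tree avoiding them\<close>

definition radius :: "nat \<Rightarrow> nat \<Rightarrow> real" where
  "radius n b = 1 / (256 * real k * real (s n) * real (a n) * 2 ^ b)"

text \<open>A rational point of height \<open>H = D * q\<^sup>2 \<in> {2 ^ b..<2 ^ (b + 1)}\<close> with \<open>b \<in> {s n..<s (n + 1)}\<close>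
  is counted at scale \<open>2 ^ - s n\<close>, but its neighbourhood is so short, and there are so many of
  them, that it is avoided by intervals of generation \<open>n + 2\<close> only; hence the shift of the index.
  Nothing is to be avoided at generation 1, which is the junk case \<open>s (0 - 1) = s 0\<close>.\<close>

definition hit :: "nat \<Rightarrow> nat \<Rightarrow> bool" where
  "hit n v \<longleftrightarrow> (\<exists>i\<in>{1..k}. \<exists>m<s n. \<exists>b\<in>{s (n - 1)..<s n}.
     \<exists>x\<in>bounded_height (partial_prod (D i) m) (2 ^ (b + 1)).
     \<exists>\<alpha>\<in>dyadic (s (Suc n)) v. \<bar>\<alpha> - x\<bar> < radius (n - 1) b)"

definition R :: "nat \<Rightarrow> nat" where
  "R n = 2 ^ a n"

text \<open>\<open>hit m\<close> concerns intervals of generation \<open>m + 1\<close>. The second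
  conjunct looks one generation ahead; it is the hypothesis \<open>half\<close> of
  \<open>two_step_avoidance\<close> and carries the induction.\<close>

definition good :: "nat \<Rightarrow> nat \<Rightarrow> bool" where
  "good n u \<longleftrightarrow> (\<forall>m. n = Suc m \<longrightarrow> \<not> hit m u) \<and> 2 * card {t. t < R n \<and> hit n (R n * u + t)} \<le> R n"

lemma partial_prod_pos: "i \<in> {1..k} \<Longrightarrow> partial_prod (D i) m > 0"
  using partial_prod_ge_power[of "D i" m] D by (smt (verit) zero_less_power)

lemma radius_pos: "radius n b > 0"
  using k s_ge_1024[of n] a_ge_2[of n] by (auto simp: radius_def intro!: divide_pos_pos mult_pos_pos)

text \<open>Union bound over \<open>i\<close>, \<open>m\<close> and \<open>b\<close>. Lengths and
  boundaries contribute at most 1/16 each: the 256 in \<open>radius\<close> is chosen for the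
  former, and \<open>two_power_a_Suc\<close> gives the latter.\<close>

lemma card_hit:
  "8 * card {u. u < R n * R (Suc n) \<and> hit (Suc n) (R n * R (Suc n) * v + u)} \<le> R n * R (Suc n)"
proof -
  let ?T = "s (Suc (Suc n))"
  let ?N = "\<lambda>i m b. {w. dyadic ?T w \<subseteq> dyadic (s n) v \<and>
     (\<exists>x\<in>bounded_height (partial_prod (D i) m) (2 ^ (b + 1)). \<exists>\<alpha>\<in>dyadic ?T w. \<bar>\<alpha> - x\<bar> < radius n b)}"
  have T: "?T = s n + a n + a (Suc n)"
    by (simp add: s_Suc)
  have RR: "R n * R (Suc n) = 2 ^ (a n + a (Suc n))"
    by (simp add: R_def power_add)
  have pos: "real k > 0" "real (s n) > 0" "real (a n) > 0"
    using k s_ge_1024[of n] a_ge_2[of n] by auto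
  have sub: "dyadic ?T (R n * R (Suc n) * v + u) \<subseteq> dyadic (s n) v" if "u < R n * R (Suc n)" for u
  proof -
    have "R n * R (Suc n) * v + u + 1 \<le> R n * R (Suc n) * (v + 1)"
      using that by simp
    then have "real (R n * R (Suc n) * v + u + 1) \<le> real (R n * R (Suc n) * (v + 1))"
      by (simp only: of_nat_le_iff)
    then have "real (R n * R (Suc n) * v + u + 1) * 2 ^ s n \<le> real (R n * R (Suc n) * (v + 1)) * 2 ^ s n"
      by (rule mult_right_mono) simp
    then show ?thesis
      by (simp add: dyadic_def T RR power_add field_simps)
  qed
  have fin: "finite {w. dyadic ?T w \<subseteq> dyadic (s n) v}"
  proof (rule finite_subset)
    show "{w. dyadic ?T w \<subseteq> dyadic (s n) v} \<subseteq> {..nat \<lceil>(real v + 1) / 2 ^ s n * 2 ^ ?T\<rceil>}"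
    proof
      fix w assume "w \<in> {w. dyadic ?T w \<subseteq> dyadic (s n) v}"
      then have w: "dyadic ?T w \<subseteq> dyadic (s n) v"
        by (rule CollectD)
      have "real w / 2 ^ ?T \<in> dyadic ?T w"
        by (simp add: dyadic_def divide_right_mono)
      then have "real w / 2 ^ ?T \<le> (real v + 1) / 2 ^ s n"
        using w by (auto simp: dyadic_def)
      then have "real w \<le> (real v + 1) / 2 ^ s n * 2 ^ ?T"
        by (simp add: field_simps)
      then show "w \<in> {..nat \<lceil>(real v + 1) / 2 ^ s n * 2 ^ ?T\<rceil>}"
        by (simp add: le_nat_iff) linarith
    qed
  qed simp
  have N: "real (card (?N i m b)) \<le> 2 ^ (b - s n + 2) * (2 * radius n b * 2 ^ ?T + 2)"
    if "i \<in> {1..k}" "s n \<le> b" for i m b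
  proof (rule card_dyadic_near_separated)
    show "\<bar>x - y\<bar> \<ge> 1 / 2 ^ (b + 1)"
      if "x \<in> bounded_height (partial_prod (D i) m) (2 ^ (b + 1))"
         "y \<in> bounded_height (partial_prod (D i) m) (2 ^ (b + 1))" "x \<noteq> y" for x y
      using bounded_height_separated[OF partial_prod_pos[OF \<open>i \<in> {1..k}\<close>] _ that] by simp
    show "dyadic (s n) v = {real v / 2 ^ s n .. real v / 2 ^ s n + 1 / 2 ^ s n}"
      by (simp add: dyadic_def add_divide_distrib)
    have "1 \<le> k * (s n * a n)"
      using k s_ge_1024[of n] a_ge_2[of n] by (simp add: Suc_le_eq)
    then have "real 1 \<le> real (k * (s n * a n))"
      by (simp only: of_nat_le_iff)
    then show "4 * radius n b * 2 ^ b \<le> 1"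
      using pos by (simp add: radius_def field_simps)
  qed (use that radius_pos in auto)
  \<comment> \<open>The first term stems from the lengths of the neighbourhoods, the second from their boundaries.\<close>
  have bound: "2 ^ (b - s n + 2) * (2 * radius n b * 2 ^ ?T + 2)
      = 2 ^ (a n + a (Suc n)) / (32 * real k * real (s n) * real (a n)) + 8 * 2 ^ (b - s n)"
    if "s n \<le> b" for b
  proof -
    have "(2::real) ^ b = 2 ^ s n * 2 ^ (b - s n)"
      using that by (simp flip: power_add)
    then show ?thesis
      using pos by (simp add: radius_def T power_add field_simps)
  qed
  \<comment> \<open>The boundary terms grow geometrically in \<open>b\<close>, so their sum carries
    no factor \<open>a n\<close>.\<close>
  have geom: "(\<Sum>b\<in>{s n..<s (Suc n)}. (2::real) ^ (b - s n)) \<le> 2 ^ a n"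
  proof -
    have "(\<Sum>b\<in>{s n..<s (Suc n)}. (2::real) ^ (b - s n)) = (\<Sum>b<a n. 2 ^ b)"
      by (rule sum.reindex_bij_witness[of _ "\<lambda>b. b + s n" "\<lambda>b. b - s n"]) (auto simp: s_Suc)
    also have "\<dots> = 2 ^ a n - 1"
      by (simp add: geometric_sum)
    finally show ?thesis by simp
  qed
  let ?H = "{u. u < R n * R (Suc n) \<and> hit (Suc n) (R n * R (Suc n) * v + u)}"
  have "card ?H \<le> card (\<Union>i\<in>{1..k}. \<Union>m\<in>{..<s (Suc n)}. \<Union>b\<in>{s n..<s (Suc n)}. ?N i m b)"
  proof (rule card_inj_on_le[where f = "\<lambda>u. R n * R (Suc n) * v + u"])
    show "(\<lambda>u. R n * R (Suc n) * v + u) ` ?H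
        \<subseteq> (\<Union>i\<in>{1..k}. \<Union>m\<in>{..<s (Suc n)}. \<Union>b\<in>{s n..<s (Suc n)}. ?N i m b)"
    proof clarify
      fix u assume u: "u < R n * R (Suc n)" "hit (Suc n) (R n * R (Suc n) * v + u)"
      then obtain i m b where "i \<in> {1..k}" "m < s (Suc n)" "b \<in> {s n..<s (Suc n)}"
         "R n * R (Suc n) * v + u \<in> ?N i m b"
        using sub[OF u(1)] unfolding hit_def diff_Suc_1 by blast
      then show "R n * R (Suc n) * v + u
          \<in> (\<Union>i\<in>{1..k}. \<Union>m\<in>{..<s (Suc n)}. \<Union>b\<in>{s n..<s (Suc n)}. ?N i m b)"
        by blast
    qed
    show "finite (\<Union>i\<in>{1..k}. \<Union>m\<in>{..<s (Suc n)}. \<Union>b\<in>{s n..<s (Suc n)}. ?N i m b)"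
      by (rule finite_subset[OF _ fin]) auto
  qed (simp add: inj_on_def)
  also have "\<dots> \<le> (\<Sum>i\<in>{1..k}. \<Sum>m\<in>{..<s (Suc n)}. \<Sum>b\<in>{s n..<s (Suc n)}. card (?N i m b))"
    by (intro order_trans[OF card_UN_le] sum_mono) simp_all
  finally have "real (card ?H)
      \<le> (\<Sum>i\<in>{1..k}. \<Sum>m\<in>{..<s (Suc n)}. \<Sum>b\<in>{s n..<s (Suc n)}. real (card (?N i m b)))"
    unfolding of_nat_sum[symmetric] of_nat_le_iff .
  also have "\<dots> \<le> (\<Sum>i\<in>{1..k}. \<Sum>m\<in>{..<s (Suc n)}. \<Sum>b\<in>{s n..<s (Suc n)}.
      2 ^ (a n + a (Suc n)) / (32 * real k * real (s n) * real (a n)) + 8 * 2 ^ (b - s n))"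
  proof (intro sum_mono)
    fix i m b assume "i \<in> {1..k}" "b \<in> {s n..<s (Suc n)}"
    then show "real (card (?N i m b))
        \<le> 2 ^ (a n + a (Suc n)) / (32 * real k * real (s n) * real (a n)) + 8 * 2 ^ (b - s n)"
      using N[of i b m] bound[of b] by simp
  qed
  also have "\<dots> = real k * real (s (Suc n)) * (real (a n) * (2 ^ (a n + a (Suc n)) / (32 * real k * real (s n) * real (a n)))
      + 8 * (\<Sum>b\<in>{s n..<s (Suc n)}. 2 ^ (b - s n)))"
    by (simp add: sum.distrib sum_distrib_left s_Suc)
  \<comment> \<open>\<open>a_le_s\<close> gives \<open>s (Suc n) \<le> 2 * s n\<close>.\<close>
  also have "\<dots> \<le> real k * (2 * real (s n)) * (real (a n) * (2 ^ (a n + a (Suc n)) / (32 * real k * real (s n) * real (a n)))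
      + 8 * 2 ^ a n)"
    using geom a_le_s[of n] pos
    by (intro mult_mono add_mono) (auto simp: s_Suc intro!: add_nonneg_nonneg sum_nonneg)
  also have "\<dots> = 2 ^ (a n + a (Suc n)) / 16 + 16 * (real k * real (s n)) * 2 ^ a n"
    using pos by (simp add: field_simps)
  also have "\<dots> \<le> 2 ^ (a n + a (Suc n)) / 16 + (2 ^ a (Suc n) / 16) * 2 ^ a n"
  proof (intro add_left_mono mult_right_mono)
    have "real (256 * k * s n) \<le> real (2 ^ a (Suc n))"
      using two_power_a_Suc[of n] by (simp only: of_nat_le_iff)
    then show "16 * (real k * real (s n)) \<le> 2 ^ a (Suc n) / 16"
      by simp
  qed simp
  also have "\<dots> = real (R n * R (Suc n)) / 8"
    by (simp add: RR power_add)
  finally have "real (8 * card ?H) \<le> real (R n * R (Suc n))"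
    by simp
  then show ?thesis
    by (simp only: of_nat_le_iff)
qed

lemma good_children:
  assumes "good n u"
  shows "2 ^ (a n - 2) \<le> card {t. t < R n \<and> good (Suc n) (R n * u + t)}"
proof -
  have "R n \<le> 4 * card {t. t < R n \<and> good (Suc n) (R n * u + t)}"
    using two_step_avoidance[of R n hit u] card_hit[of n u] assms
    by (simp add: good_def R_def)
  moreover have "R n = 4 * 2 ^ (a n - 2)"
    unfolding R_def by (rule two_power_a_diff)
  ultimately show ?thesis by simp
qed

lemma good_root: "good 0 0"
  by (simp add: good_def hit_def)

text \<open>The branching \<open>2 ^ (a n - 2)\<close> is exactly \<open>R n / 4\<close>, as
  \<open>a n \<ge> 2\<close>.\<close>

sublocale cantor_tree R "\<lambda>n. 2 ^ (a n - 2)" "\<lambda>n. 2 ^ s n" good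
proof
  show "\<exists>n. B < real (2 ^ s n)" for B
  proof -
    obtain n where "B < 2 ^ n"
      using real_arch_pow[of 2 B] by auto
    also have "(2::real) ^ n \<le> 2 ^ s n"
      by (intro power_increasing s_ge_self) simp
    finally show ?thesis
      by (intro exI[of _ n]) simp
  qed
qed (simp_all add: good_root good_children, simp_all add: R_def s_Suc power_add)

section \<open>The loss from discarding cells\<close>

lemma two_power_s: "(2::real) ^ s n = 2 ^ s 0 * 4 ^ n * real (\<Prod>i<n. 2 ^ (a i - 2))"
proof (induction n)
  case (Suc n)
  have "(2::real) ^ s (Suc n) = 2 ^ s n * (4 * 2 ^ (a n - 2))"
    by (simp only: s_Suc power_add two_power_a_diff)
  then show ?case
    by (simp add: Suc.IH del: s.simps)
qed simp

text \<open>By \<open>two_power_s\<close> the loss is \<open>4 ^ n\<close> up to a constant. The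
  increments \<open>a n\<close> are unbounded, so \<open>s n\<close> outgrows every multiple of
  \<open>n\<close>.\<close>

lemma growth:
  assumes "\<epsilon> > 0"
  shows "\<exists>C. \<forall>n. real (2 ^ s (Suc n)) \<le> C * real (\<Prod>i<Suc n. 2 ^ (a i - 2)) * real (2 ^ s n) powr \<epsilon>"
proof -
  obtain j :: nat where j: "real j > 1 / \<epsilon>"
    using reals_Archimedean2 by blast
  define n0 where "n0 = (2::nat) ^ j"
  \<comment> \<open>From \<open>n0\<close> on, each generation adds at least 2 to
    \<open>\<epsilon> * s n\<close>, which pays for its factor 4; earlier ones go into the constant
    \<open>4 ^ n0\<close>.\<close>
  have step: "\<epsilon> * real (a n) \<ge> 2" if "n \<ge> n0" for n
  proof -
    have "2 * j \<le> a n"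
      using a_ge[of j] a_mono[of n0 n] that by (simp add: n0_def)
    then have "\<epsilon> * real (2 * j) \<le> \<epsilon> * real (a n)"
      using assms by (intro mult_left_mono) simp_all
    moreover have "\<epsilon> * real j \<ge> 1"
      using j assms by (simp add: field_simps)
    ultimately show ?thesis by simp
  qed
  have lin: "2 * real n \<le> 2 * real n0 + \<epsilon> * real (s n)" for n
  proof (induction n)
    case (Suc n)
    show ?case
    proof (cases "n \<ge> n0")
      case True
      then show ?thesis
        using Suc step[of n] by (simp add: s_Suc distrib_left)
    next
      case False
      then have "2 * real (Suc n) \<le> 2 * real n0"
        by simp
      moreover have "0 \<le> \<epsilon> * real (s (Suc n))"
        using assms by simp
      ultimately show ?thesis
        by (intro add_increasing2)
    qed
  qed (use assms in simp)
  show ?thesis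
  proof (intro exI[of _ "2 ^ s 0 * 4 * 4 ^ n0"] allI)
    fix n
    have "(4::real) ^ n = 2 powr (2 * real n)"
      by (simp add: powr_powr[symmetric] powr_realpow)
    also have "\<dots> \<le> 2 powr (2 * real n0 + \<epsilon> * real (s n))"
      using lin by simp
    also have "\<dots> = 4 ^ n0 * real (2 ^ s n) powr \<epsilon>"
      by (simp add: powr_add powr_powr[symmetric] powr_realpow mult.commute[of \<epsilon>])
    finally have "(4::real) ^ n \<le> 4 ^ n0 * real (2 ^ s n) powr \<epsilon>" .
    then have "(2 ^ s 0 * 4 * real (\<Prod>i<Suc n. 2 ^ (a i - 2))) * 4 ^ n
        \<le> (2 ^ s 0 * 4 * real (\<Prod>i<Suc n. 2 ^ (a i - 2))) * (4 ^ n0 * real (2 ^ s n) powr \<epsilon>)"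
      by (intro mult_left_mono) (auto intro!: mult_nonneg_nonneg prod_nonneg)
    then show "real (2 ^ s (Suc n))
        \<le> 2 ^ s 0 * 4 * 4 ^ n0 * real (\<Prod>i<Suc n. 2 ^ (a i - 2)) * real (2 ^ s n) powr \<epsilon>"
      using two_power_s[of "Suc n"] by (simp add: mult_ac del: prod.lessThan_Suc s.simps)
  qed
qed

section \<open>Limit points are badly approximable\<close>

lemma log_star_lower_bound:
  assumes q: "q > 0" "real q ^ 2 \<ge> 2 ^ s n"
  shows "log_star (real q) * log_star (ln (real q)) \<ge> real (s n) * real (a n) / 32"
proof -
  let ?S = "real (s n)"
  have S: "?S \<ge> 1024"
    using s_ge_1024[of n] by simp
  have ln2: "ln 2 \<ge> (1::real) / 2"
    using ln2_ge_two_thirds by simp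
  \<comment> \<open>The bounds \<open>?S / 4\<close> for \<open>ln q\<close> and
    \<open>a n / 8\<close> for \<open>ln (ln q)\<close> multiply to the constant 32.\<close>
  have "?S * ln 2 = ln (2 ^ s n)"
    by (simp add: ln_realpow)
  also have "\<dots> \<le> ln (real q ^ 2)"
    using q by (subst ln_le_cancel_iff) auto
  also have "\<dots> = 2 * ln (real q)"
    using q by (simp add: ln_realpow)
  finally have "?S * (1 / 2) \<le> 2 * ln (real q)"
    using ln2 mult_left_mono[OF ln2, of ?S] by linarith
  then have lnq: "ln (real q) \<ge> ?S / 4"
    by simp
  have "real (a n) * ln 2 = ln (real (2 ^ a n))"
    by (simp add: ln_realpow)
  also have "\<dots> \<le> ln (real ((s n)\<^sup>2))"
    using two_power_a(1)[of n] S by (subst ln_le_cancel_iff) (simp_all only: of_nat_le_iff, auto)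
  also have "\<dots> = 2 * ln ?S"
    using S by (simp add: ln_realpow)
  finally have "real (a n) * (1 / 2) \<le> 2 * ln ?S"
    using mult_left_mono[OF ln2, of "real (a n)"] by linarith
  then have a_ln: "real (a n) / 8 \<le> ln ?S / 2"
    by simp
  \<comment> \<open>For \<open>?S \<ge> 16\<close>, dividing \<open>?S\<close> by 4 at most halves
    its logarithm.\<close>
  have "16 * ?S \<le> ?S * ?S"
    using S by (intro mult_right_mono) auto
  then have "?S \<le> (?S / 4)\<^sup>2"
    by (simp add: power2_eq_square)
  then have "ln ?S \<le> ln ((?S / 4)\<^sup>2)"
    using S by (subst ln_le_cancel_iff) auto
  also have "\<dots> = 2 * ln (?S / 4)"
    using S by (subst ln_realpow) auto
  also have "ln (?S / 4) \<le> ln (ln (real q))"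
    using S lnq by (subst ln_le_cancel_iff) auto
  finally have "real (a n) / 8 \<le> ln (ln (real q))"
    using a_ln by simp
  also have "\<dots> \<le> log_star (ln (real q))"
    using lnq S by (intro log_star_ge_ln) simp
  finally have *: "real (a n) / 8 \<le> log_star (ln (real q))" .
  have "?S / 4 \<le> log_star (real q)"
    using lnq log_star_ge_ln[of "real q"] q by simp
  moreover have "0 \<le> log_star (real q)"
    using calculation S by linarith
  ultimately show ?thesis
    using mult_mono[OF _ *, of "?S / 4" "log_star (real q)"] by simp
qed

text \<open>The height \<open>H\<close> of the fraction \<open>x\<close> nearest to
  \<open>\<alpha>\<close> with denominator \<open>q\<close> decides which generation avoids
  \<open>x\<close>, and the product is \<open>f(q)\<close> times
  \<open>H * \<bar>\<alpha> - x\<bar>\<close>. The constant is \<open>8192 = 32 * 256\<close>, from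
  \<open>log_star_lower_bound\<close> and \<open>radius\<close>.\<close>

lemma limit_point_value:
  assumes \<alpha>: "\<And>n. \<exists>u. good n u \<and> \<alpha> \<in> dyadic (s n) u"
    and i: "i \<in> {1..k}" and q: "q \<ge> 2 ^ s 0"
  shows "log_star (real q) * log_star (ln (real q)) * real q * pseudo_abs (D i) (int q) * dist_int (real q * \<alpha>)
     \<ge> 1 / (8192 * real k)"
proof -
  have "q > 0"
    using q by (metis gr0I not_le zero_less_numeral zero_less_power)
  obtain m where m: "partial_prod (D i) m dvd int q"
      "pseudo_abs (D i) (int q) = 1 / of_int (partial_prod (D i) m)"
    using pseudo_abs_attained[of "D i" "int q"] D[OF i] \<open>q > 0\<close> by auto
  define d where "d = partial_prod (D i) m"
  have d: "d > 0"
    using partial_prod_pos[OF i] by (simp add: d_def)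
  obtain q' where q': "int q = d * q'"
    using m by (auto simp: d_def dvd_def)
  have q'_pos: "q' \<ge> 1"
    using q' d \<open>q > 0\<close> by (smt (verit) mult_le_0_iff of_nat_0_less_iff)
  define H where "H = q * nat q'"
  have H: "int H = d * q'\<^sup>2"
    using q' q'_pos by (simp add: H_def power2_eq_square)
  have "1 \<le> nat q'"
    using q'_pos by linarith
  have qH: "q \<le> H"
    using mult_le_mono2[OF \<open>1 \<le> nat q'\<close>, of q] by (simp only: H_def mult_1_right)
  have Hq: "H \<le> q ^ 2"
  proof -
    have "q' \<le> d * q'"
      using d q'_pos by simp
    then have "nat q' \<le> q"
      using q' by linarith
    then show ?thesis
      by (simp add: H_def power2_eq_square)
  qed
  define b where "b = floor_log H"
  have b: "2 ^ b \<le> H" "H < 2 ^ (b + 1)"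
    using floor_log_exp2_le[of H] floor_log_exp2_gt[of H] qH \<open>q > 0\<close> by (auto simp: b_def)
  \<comment> \<open>Large \<open>q\<close> forces \<open>s 0 \<le> b\<close>, so that
    \<open>N\<close> below is positive.\<close>
  have "(2::nat) ^ s 0 < 2 ^ (b + 1)"
    using q qH b by linarith
  then have "s 0 \<le> b"
    using power_strict_increasing_iff[of "2::nat" "s 0" "b + 1"] by (simp del: s.simps)
  have "\<exists>n. b < s n"
    using s_ge_self[of "Suc b"] by (intro exI[of _ "Suc b"]) simp
  define N where "N = (LEAST n. b < s n)"
  have N: "b < s N"
    unfolding N_def using \<open>\<exists>n. b < s n\<close> by (rule LeastI_ex)
  then obtain n where n: "N = Suc n"
    using \<open>s 0 \<le> b\<close> by (cases N) auto
  have sn: "s n \<le> b"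
    using not_less_Least[of n "\<lambda>n. b < s n"] n by (simp add: N_def)
  \<comment> \<open>Since \<open>2 ^ m \<le> d \<le> q \<le> H\<close>, the range of
    \<open>m\<close> in \<open>hit\<close> suffices.\<close>
  have "m < s N"
  proof -
    have "(2::int) ^ m \<le> d"
      unfolding d_def using D[OF i] by (intro partial_prod_ge_power)
    also have "d \<le> int q"
      using q' d q'_pos by simp
    also have "\<dots> < 2 ^ (b + 1)"
      using qH b(2) by (metis le_less_trans of_nat_less_iff of_nat_numeral of_nat_power)
    finally have "m < b + 1"
      using power_strict_increasing_iff[of "2::int" m "b + 1"] by simp
    then show ?thesis
      using N by simp
  qed
  define x where "x = of_int (round (real q * \<alpha>)) / real q"
  have x: "x \<in> bounded_height d (2 ^ (b + 1))"
  proof -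
    have "real q = of_int (d * q')"
      using q' by (metis of_int_of_nat_eq)
    moreover have "d * q'\<^sup>2 < 2 ^ (b + 1)"
      using b(2) unfolding H[symmetric] by (metis of_nat_less_iff of_nat_numeral of_nat_power)
    ultimately show ?thesis
      unfolding bounded_height_def x_def using q'_pos by auto
  qed
  obtain u where u: "good (Suc N) u" "\<alpha> \<in> dyadic (s (Suc N)) u"
    using \<alpha> by blast
  then have "\<not> hit N u"
    by (simp add: good_def)
  then have "\<not> \<bar>\<alpha> - x\<bar> < radius n b"
    using i \<open>m < s N\<close> sn N x u(2) unfolding hit_def n diff_Suc_1 d_def by auto
  then have far: "radius n b \<le> \<bar>\<alpha> - x\<bar>"
    by simp
  have dist: "dist_int (real q * \<alpha>) = real q * \<bar>\<alpha> - x\<bar>"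
  proof -
    have "real q * \<bar>\<alpha> - x\<bar> = \<bar>real q * (\<alpha> - x)\<bar>"
      by (simp add: abs_mult)
    also have "real q * (\<alpha> - x) = real q * \<alpha> - of_int (round (real q * \<alpha>))"
      using \<open>q > 0\<close> by (simp add: x_def right_diff_distrib)
    finally show ?thesis
      by (simp add: dist_int_def)
  qed
  have height: "real H = real q * real q / of_int d"
  proof -
    have "real q = of_int d * of_int q'"
      using q' by (metis of_int_mult of_int_of_nat_eq)
    moreover have "real H = of_int d * of_int q' ^ 2"
      using H by (metis of_int_mult of_int_of_nat_eq of_int_power)
    ultimately show ?thesis
      using d by (simp add: power2_eq_square)
  qed
  have eq: "real q * pseudo_abs (D i) (int q) * dist_int (real q * \<alpha>) = real H * \<bar>\<alpha> - x\<bar>"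
    unfolding m(2) d_def[symmetric] dist height by simp
  have pos: "real k > 0" "real (s n) > 0" "real (a n) > 0"
    using k s_ge_1024[of n] a_ge_2[of n] by auto
  have f: "log_star (real q) * log_star (ln (real q)) \<ge> real (s n) * real (a n) / 32"
  proof (rule log_star_lower_bound)
    have "(2::nat) ^ s n \<le> 2 ^ b"
      using sn by simp
    then have "(2::nat) ^ s n \<le> q ^ 2"
      using b Hq by linarith
    then have "real (2 ^ s n) \<le> real (q ^ 2)"
      by (simp only: of_nat_le_iff)
    then show "2 ^ s n \<le> (real q)\<^sup>2"
      by simp
  qed fact
  have "real (2 ^ b) \<le> real H"
    using b(1) by (simp only: of_nat_le_iff)
  then have "2 ^ b * radius n b \<le> real H * \<bar>\<alpha> - x\<bar>"
    using far radius_pos[of n b] by (intro mult_mono) auto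
  then have "(real (s n) * real (a n) / 32) * (2 ^ b * radius n b)
      \<le> log_star (real q) * log_star (ln (real q)) * (real H * \<bar>\<alpha> - x\<bar>)"
  proof (rule mult_mono[OF f])
    show "0 \<le> log_star (real q) * log_star (ln (real q))"
      using pos by (intro order_trans[OF _ f]) simp
    show "0 \<le> 2 ^ b * radius n b"
      using radius_pos[of n b] by simp
  qed
  moreover have "(real (s n) * real (a n) / 32) * (2 ^ b * radius n b) = 1 / (8192 * real k)"
    using pos by (simp add: radius_def field_simps)
  ultimately show ?thesis
    by (simp add: eq[symmetric] mult.assoc)
qed

end

section \<open>The dimension of the intersection\<close>

theorem theorem6:
  fixes k :: nat and \<D> :: "nat \<Rightarrow> nat \<Rightarrow> int" and f :: "nat \<Rightarrow> real"
  assumes "k \<ge> 1"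
    and "\<And>i j. i \<in> {1..k} \<Longrightarrow> j \<ge> 1 \<Longrightarrow> \<D> i j \<ge> 2"
    and "\<And>q. q \<ge> 1 \<Longrightarrow> f q = log_star (real q) * log_star (ln (real q))"
  shows "hausdorff_dim (\<Inter>i\<in>{1..k}. Bad (\<D> i) f) = 1"
proof (rule antisym)
  interpret avoidance k \<D>
    using assms(1,2) by unfold_locales
  let ?E = "\<Inter>i\<in>{1..k}. Bad (\<D> i) f"
  have E: "\<alpha> \<in> ?E"
    if \<alpha>: "\<And>n. \<exists>u. good n u \<and> \<alpha> \<in> {real u / real (2 ^ s n) .. (real u + 1) / real (2 ^ s n)}" for \<alpha>
  proof (rule INT_I)
    fix i assume i: "i \<in> {1..k}"
    have \<alpha>': "\<exists>u. good n u \<and> \<alpha> \<in> dyadic (s n) u" for n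
      using \<alpha>[of n] by (simp add: dyadic_def)
    have "1 / (8192 * real k) \<le> f q * real q * pseudo_abs (\<D> i) (int q) * dist_int (real q * \<alpha>)"
      if "q \<ge> 2 ^ s 0" for q
    proof -
      have "q \<ge> 1"
        using that by (meson le_trans one_le_numeral one_le_power)
      then show ?thesis
        using limit_point_value[OF \<alpha>' i that] by (simp add: assms(3))
    qed
    then have le: "ereal (1 / (8192 * real k))
        \<le> liminf (\<lambda>q. ereal (f q * real q * pseudo_abs (\<D> i) (int q) * dist_int (real q * \<alpha>)))"
      by (intro Liminf_bounded) (auto simp: eventually_sequentially simp del: s.simps)
    have "0 < ereal (1 / (8192 * real k))"
      using assms(1) by simp
    from less_le_trans[OF this le] show "\<alpha> \<in> Bad (\<D> i) f"
      by (simp add: Bad_def)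
  qed
  show "1 \<le> hausdorff_dim ?E"
    unfolding hausdorff_dim_def
  proof (rule INF_greatest, clarify)
    fix \<sigma> :: real assume \<sigma>: "0 \<le> \<sigma>" "hausdorff_measure \<sigma> ?E = 0"
    have "\<sigma> \<ge> 1"
    proof (rule ccontr)
      assume "\<not> \<sigma> \<ge> 1"
      \<comment> \<open>\<open>\<sigma> < 1\<close> leaves the exponent
        \<open>1 - \<sigma> > 0\<close> to absorb the loss.\<close>
      then obtain C where "\<And>n. real (2 ^ s (Suc n))
          \<le> C * real (\<Prod>i<Suc n. 2 ^ (a i - 2)) * real (2 ^ s n) powr (1 - \<sigma>)"
        using growth[of "1 - \<sigma>"] by auto
      then have "hausdorff_measure \<sigma> ?E \<noteq> 0"
        using \<sigma> \<open>\<not> \<sigma> \<ge> 1\<close> E by (intro hausdorff_measure_nonzero) auto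
      then show False
        using \<sigma> by simp
    qed
    then show "1 \<le> ennreal \<sigma>"
      by (simp flip: ennreal_1 add: ennreal_leI)
  qed
qed (rule hausdorff_dim_real_le_1)

end
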